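(* Let $\{l_{\mathrm M}(i)\in\{0,1\}\}_{i\in\mathbb{N}_0}$ be a binary-valued stochastic process satisfying, for some $\kappa\ge 0$ and $\tau>1$, $$\mathbb{P}\Big[\sum_{i=0}^{k-1}l_{\mathrm M}(i)\le\kappa+\frac{k}{\tau}\Big]=1,\quad k\in\mathbb{N}.$$ Then $$\sum_{k=1}^{\infty}\mathbb{P}\Big[\sum_{i=0}^{k-1}l_{\mathrm M}(i)>\rho_{\mathrm M}k\Big]<\infty\quad\text{for all }\rho_{\mathrm M}\in\Big(\frac1\tau,1\Big).$$
   Context: $\mathbb{N}$ and $\mathbb{N}_0$ denote the positive and nonnegative integers. *)

theory Defs
  imports "HOL-Probability.Probability"
begin

end

theory Submission
  imports Defs
begin

text \<open>Since \<open>\<rho> > 1 / \<tau>\<close>, the line \<open>\<rho> k\<close> lies above \<open>\<kappa> + k / \<tau>\<close> as soon as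
  \<open>k \<ge> \<kappa> / (\<rho> - 1 / \<tau>)\<close>. From there on the events are null, so the series is a finite sum.\<close>

theorem lemma2p3:
  fixes M :: "'a measure" and l_M :: "nat \<Rightarrow> 'a \<Rightarrow> real" and \<kappa> \<tau> :: real
  assumes "prob_space M"
    and "\<And>i. l_M i \<in> M \<rightarrow>\<^sub>M count_space {0, 1}"
    and "\<kappa> \<ge> 0" and "\<tau> > 1"
    and "\<And>k::nat. k \<ge> 1 \<Longrightarrow> \<P>(\<omega> in M. (\<Sum>i<k. l_M i \<omega>) \<le> \<kappa> + real k / \<tau>) = 1"
  shows "\<forall>\<rho>\<^sub>M\<in>{1 / \<tau><..<1}.
    summable (\<lambda>k. \<P>(\<omega> in M. (\<Sum>i<Suc k. l_M i \<omega>) > \<rho>\<^sub>M * real (Suc k)))"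
proof
  interpret prob_space M by fact
  fix \<rho> assume "\<rho> \<in> {1 / \<tau><..<1}"
  then have gap: "\<rho> - 1 / \<tau> > 0" by simp
  define K where "K = nat \<lceil>\<kappa> / (\<rho> - 1 / \<tau>)\<rceil>"
  have null: "\<P>(\<omega> in M. (\<Sum>i<Suc k. l_M i \<omega>) > \<rho> * real (Suc k)) = 0" if "k \<ge> K" for k
  proof (rule prob_eq_0_AE)
    \<comment> \<open>Term \<open>k\<close> of the series concerns the partial sum of length
      \<open>Suc k\<close>, which exceeds the threshold \<open>K\<close>.\<close>
    have "\<kappa> / (\<rho> - 1 / \<tau>) \<le> real (Suc k)"
      using that unfolding K_def by linarith
    \<comment> \<open>Multiplying by the positive \<open>\<rho> - 1 / \<tau>\<close> keeps the
      direction of the inequality.\<close>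
    then have le: "\<kappa> + real (Suc k) / \<tau> \<le> \<rho> * real (Suc k)"
      using gap by (simp add: pos_divide_le_eq right_diff_distrib mult.commute)
    \<comment> \<open>An event of probability one holds almost everywhere; by \<open>le\<close>,
      this one excludes exceeding \<open>\<rho> * real (Suc k)\<close>.\<close>
    have "AE \<omega> in M. \<omega> \<in> {\<omega> \<in> space M. (\<Sum>i<Suc k. l_M i \<omega>) \<le> \<kappa> + real (Suc k) / \<tau>}"
      by (rule AE_prob_1, rule assms(5)) simp
    then show "AE \<omega> in M. \<not> (\<Sum>i<Suc k. l_M i \<omega>) > \<rho> * real (Suc k)"
      using le by (auto elim!: eventually_mono)
  qed
  show "summable (\<lambda>k. \<P>(\<omega> in M. (\<Sum>i<Suc k. l_M i \<omega>) > \<rho> * real (Suc k)))"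
    by (rule summable_finite[of "{..<K}"]) (use null in auto)
qed

end
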